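(* For any image-finite pointed partial epistemic models $(\mathcal M,s)$ and $(\mathcal M',s')$, \[ (\mathcal M,s)\mathrel{\underline{\leftrightarrow}}(\mathcal M',s') \quad\Longleftrightarrow\quad (\mathcal M,s)\equiv^{\mathsf{par}}(\mathcal M',s'). \]
   Context: Let $A$ be a finite set of agents and $P_a$ ($a\in A$) mutually disjoint countable sets of local atoms; $\mathcal L^+$ is $\varphi ::= a \mid p_a \mid \neg\varphi \mid (\varphi\wedge\varphi)\mid \widehat K_a\varphi$. A partial epistemic model $\mathcal M=(S,\sim,L)$ has a set of states $S$, for each agent $a$ a partial equivalence relation $\sim_a$ (an equivalence relation on the set $S_a$ of states where $a$ is alive), such that the relations are proper (for distinct $s,t$ some $b$ alive in $s$ has $s\not\sim_b t$), and a valuation $L\colon S\to 2^{A\cup\bigcup_a P_a}$ with $p_a\in L(s)\iff p_a\in L(t)$ whenever $s\sim_a t$, and $a\in L(u)$ iff $u\in S_a$; $A_s$ denotes agents alive in $s$. It is image-finite iff each equivalence class $[s]_a$ is finite. Three-valued semantics: $a$ is always defined and true at $s$ iff $s\in S_a$; $p_a$ is defined at $s$ iff $s\in S_a$ and true iff moreover $p_a\in L(s)$; $\neg\varphi$ is defined iff $\varphi$ is, and true iff $\varphi$ is defined and not true; $\varphi\wedge\psi$ is defined iff both are, true iff both true; $\widehat K_a\varphi$ is defined (true) at $s$ iff $\varphi$ is defined (true) at some $t\sim_a s$. $(\mathcal M,s)\equiv^{\mathsf{par}}(\mathcal M',s')$ means every $\varphi\in\mathcal L^+$ is defined, true, and has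 true negation at $s$ iff the same holds at $s'$. $(\mathcal M,s)\mathrel{\underline{\leftrightarrow}}(\mathcal M',s')$ means there is a life bisimulation ${\mathcal Z}$ with $s{\mathcal Z}s'$: a nonempty ${\mathcal Z}\subseteq S\times S'$ such that whenever $u{\mathcal Z}u'$: $L(u)\cap A=L'(u')\cap A$ and $L(u)\cap P_a=L'(u')\cap P_a$ for each $a\in A_u$; for all $a\in A_u$ and $t\sim_a u$ there is $t'\sim'_a u'$ with $t{\mathcal Z}t'$; and for all $a\in A_{u'}$ and $t'\sim'_a u'$ there is $t\sim_a u$ with $t{\mathcal Z}t'$. *)

theory Defs
  imports Main "HOL-Library.Countable_Set" "HOL-Library.Disjoint_Sets"
begin

text \<open>
  Throughout, \<open>A\<close> is the set of agents and \<open>P a\<close> is the set of local atoms of agent \<open>a\<close>.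
\<close>

definition signature :: "'ag set \<Rightarrow> ('ag \<Rightarrow> 'p set) \<Rightarrow> bool" where
  "signature A P \<longleftrightarrow>
     finite A \<and> (\<forall>a\<in>A. countable (P a)) \<and> disjoint_family_on P A"

text \<open>
  A local atom carries its owner: \<open>Atom a p\<close> is the formula $p_a$.
\<close>

datatype ('ag, 'p) form =
    Live 'ag
  | Atom 'ag 'p
  | Neg "('ag, 'p) form"
  | Conj "('ag, 'p) form" "('ag, 'p) form"
  | Poss 'ag "('ag, 'p) form"

inductive_set language :: "'ag set \<Rightarrow> ('ag \<Rightarrow> 'p set) \<Rightarrow> ('ag, 'p) form set"
  for A :: "'ag set" and P :: "'ag \<Rightarrow> 'p set" where
  Live: "a \<in> A \<Longrightarrow> Live a \<in> language A P"
| Atom: "a \<in> A \<Longrightarrow> p \<in> P a \<Longrightarrow> Atom a p \<in> language A P"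
| Neg: "\<phi> \<in> language A P \<Longrightarrow> Neg \<phi> \<in> language A P"
| Conj: "\<phi> \<in> language A P \<Longrightarrow> \<psi> \<in> language A P \<Longrightarrow> Conj \<phi> \<psi> \<in> language A P"
| Poss: "a \<in> A \<Longrightarrow> \<phi> \<in> language A P \<Longrightarrow> Poss a \<phi> \<in> language A P"

text \<open>
  Valuations take values in the disjoint union of agents and local atoms: \<open>Inl a\<close> is the agent
  \<open>a\<close> used as a propositional variable, \<open>Inr p\<close> is the local atom \<open>p\<close>.
\<close>

record ('ag, 'p, 's) model =
  states :: "'s set"
  rel :: "'ag \<Rightarrow> ('s \<times> 's) set"
  val :: "'s \<Rightarrow> ('ag + 'p) set"

text \<open>
  The domain $S_a$ of the partial equivalence relation of \<open>a\<close>, and the set $A_s$ of agents alive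
  in \<open>s\<close>.
\<close>

definition alive_states :: "('ag, 'p, 's) model \<Rightarrow> 'ag \<Rightarrow> 's set" where
  "alive_states M a = {s \<in> states M. (s, s) \<in> rel M a}"

definition alive_agents :: "'ag set \<Rightarrow> ('ag, 'p, 's) model \<Rightarrow> 's \<Rightarrow> 'ag set" where
  "alive_agents A M s = {a \<in> A. s \<in> alive_states M a}"

definition partial_epistemic_model ::
  "'ag set \<Rightarrow> ('ag \<Rightarrow> 'p set) \<Rightarrow> ('ag, 'p, 's) model \<Rightarrow> bool" where
  "partial_epistemic_model A P M \<longleftrightarrow>
     (\<forall>a\<in>A. rel M a \<subseteq> states M \<times> states M \<and> sym (rel M a) \<and> trans (rel M a)) \<and>
     (\<forall>s\<in>states M. \<forall>t\<in>states M. s \<noteq> t \<longrightarrow> (\<exists>b\<in>alive_agents A M s. (s, t) \<notin> rel M b)) \<and>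
     (\<forall>s\<in>states M. val M s \<subseteq> A <+> (\<Union>a\<in>A. P a)) \<and>
     (\<forall>a\<in>A. \<forall>p\<in>P a. \<forall>s t. (s, t) \<in> rel M a \<longrightarrow> (Inr p \<in> val M s \<longleftrightarrow> Inr p \<in> val M t)) \<and>
     (\<forall>a\<in>A. \<forall>u\<in>states M. Inl a \<in> val M u \<longleftrightarrow> u \<in> alive_states M a)"

definition image_finite :: "'ag set \<Rightarrow> ('ag, 'p, 's) model \<Rightarrow> bool" where
  "image_finite A M \<longleftrightarrow> (\<forall>a\<in>A. \<forall>s\<in>states M. finite (rel M a `` {s}))"

primrec is_defined :: "('ag, 'p, 's) model \<Rightarrow> 's \<Rightarrow> ('ag, 'p) form \<Rightarrow> bool" where
  "is_defined M s (Live a) \<longleftrightarrow> True"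
| "is_defined M s (Atom a p) \<longleftrightarrow> s \<in> alive_states M a"
| "is_defined M s (Neg \<phi>) \<longleftrightarrow> is_defined M s \<phi>"
| "is_defined M s (Conj \<phi> \<psi>) \<longleftrightarrow> is_defined M s \<phi> \<and> is_defined M s \<psi>"
| "is_defined M s (Poss a \<phi>) \<longleftrightarrow> (\<exists>t. (s, t) \<in> rel M a \<and> is_defined M t \<phi>)"

primrec is_true :: "('ag, 'p, 's) model \<Rightarrow> 's \<Rightarrow> ('ag, 'p) form \<Rightarrow> bool" where
  "is_true M s (Live a) \<longleftrightarrow> s \<in> alive_states M a"
| "is_true M s (Atom a p) \<longleftrightarrow> s \<in> alive_states M a \<and> Inr p \<in> val M s"
| "is_true M s (Neg \<phi>) \<longleftrightarrow> is_defined M s \<phi> \<and> \<not> is_true M s \<phi>"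
| "is_true M s (Conj \<phi> \<psi>) \<longleftrightarrow> is_true M s \<phi> \<and> is_true M s \<psi>"
| "is_true M s (Poss a \<phi>) \<longleftrightarrow> (\<exists>t. (s, t) \<in> rel M a \<and> is_true M t \<phi>)"

definition par_equiv ::
  "'ag set \<Rightarrow> ('ag \<Rightarrow> 'p set) \<Rightarrow> ('ag, 'p, 's) model \<Rightarrow> 's \<Rightarrow> ('ag, 'p, 't) model \<Rightarrow> 't \<Rightarrow> bool"
  where
  "par_equiv A P M s M' s' \<longleftrightarrow>
     (\<forall>\<phi>\<in>language A P.
        (is_defined M s \<phi> \<longleftrightarrow> is_defined M' s' \<phi>) \<and>
        (is_true M s \<phi> \<longleftrightarrow> is_true M' s' \<phi>) \<and>
        (is_true M s (Neg \<phi>) \<longleftrightarrow> is_true M' s' (Neg \<phi>)))"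

definition life_bisimulation ::
  "'ag set \<Rightarrow> ('ag \<Rightarrow> 'p set) \<Rightarrow> ('ag, 'p, 's) model \<Rightarrow> ('ag, 'p, 't) model \<Rightarrow> ('s \<times> 't) set \<Rightarrow> bool"
  where
  "life_bisimulation A P M M' Z \<longleftrightarrow>
     Z \<noteq> {} \<and> Z \<subseteq> states M \<times> states M' \<and>
     (\<forall>(u, u')\<in>Z.
        val M u \<inter> Inl ` A = val M' u' \<inter> Inl ` A \<and>
        (\<forall>a\<in>alive_agents A M u. val M u \<inter> Inr ` P a = val M' u' \<inter> Inr ` P a) \<and>
        (\<forall>a\<in>alive_agents A M u. \<forall>t. (u, t) \<in> rel M a \<longrightarrow>
           (\<exists>t'. (u', t') \<in> rel M' a \<and> (t, t') \<in> Z)) \<and>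
        (\<forall>a\<in>alive_agents A M' u'. \<forall>t'. (u', t') \<in> rel M' a \<longrightarrow>
           (\<exists>t. (u, t) \<in> rel M a \<and> (t, t') \<in> Z)))"

definition life_bisimilar ::
  "'ag set \<Rightarrow> ('ag \<Rightarrow> 'p set) \<Rightarrow> ('ag, 'p, 's) model \<Rightarrow> 's \<Rightarrow> ('ag, 'p, 't) model \<Rightarrow> 't \<Rightarrow> bool"
  where
  "life_bisimilar A P M s M' s' \<longleftrightarrow> (\<exists>Z. life_bisimulation A P M M' Z \<and> (s, s') \<in> Z)"

end

theory Submission imports Defs begin

text \<open>
  From right to left, par-equivalence is itself a life bisimulation, as in the Hennessy--Milner
  theorem. The usual argument needs that inequivalent states are separated by a formula
  \<^emph>\<open>true\<close> at the first and not true at the second; the difficulty is a formula \<open>\<phi>\<close> that is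
  undefined at the first state and defined at the second. There is a formula \<open>definedness \<phi>\<close> that
  is true exactly where \<open>\<phi>\<close> is defined, and iterating \<open>definedness\<close> leads to formulas that are
  defined everywhere. All iterates are true at the second state; the first iterate defined at the
  first state is not true there because its predecessor is undefined, so its negation separates
  the two states.
\<close>

lemma is_true_imp_is_defined: "is_true M s \<phi> \<Longrightarrow> is_defined M s \<phi>"
  by (induction \<phi> arbitrary: s) auto

lemma rel_imp_alive:
  assumes "partial_epistemic_model A P M" "a \<in> A" "(s, t) \<in> rel M a"
  shows "s \<in> alive_states M a"
proof -
  have "rel M a \<subseteq> states M \<times> states M" "sym (rel M a)" "trans (rel M a)"
    using assms unfolding partial_epistemic_model_def by auto
  then have "(s, s) \<in> rel M a" "s \<in> states M"
    using assms(3) by (auto dest: symD transD)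
  then show ?thesis
    by (simp add: alive_states_def)
qed

lemma rel_imp_states:
  assumes "partial_epistemic_model A P M" "a \<in> A" "(s, t) \<in> rel M a"
  shows "t \<in> states M"
  using assms unfolding partial_epistemic_model_def by auto

lemma Inl_val_iff:
  assumes "partial_epistemic_model A P M" "a \<in> A" "s \<in> states M"
  shows "Inl a \<in> val M s \<longleftrightarrow> s \<in> alive_states M a"
  using assms unfolding partial_epistemic_model_def by auto

subsection \<open>Definedness as a formula\<close>

text \<open>Bounds how often \<open>definedness\<close> must be iterated before the result is
  defined everywhere. Atoms count 1, like \<open>Poss\<close>, as both are undefined where their
  agent is dead; rank 0 leaves only negations and conjunctions of \<open>Live\<close>.\<close>

primrec rank :: "('ag, 'p) form \<Rightarrow> nat" where
  "rank (Live a) = 0"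
| "rank (Atom a p) = 1"
| "rank (Neg \<phi>) = rank \<phi>"
| "rank (Conj \<phi> \<psi>) = max (rank \<phi>) (rank \<psi>)"
| "rank (Poss a \<phi>) = Suc (rank \<phi>)"

abbreviation tautology :: "'ag \<Rightarrow> ('ag, 'p) form" where
  "tautology a \<equiv> Neg (Conj (Live a) (Neg (Live a)))"

text \<open>
  The case distinction in the last clause makes the rank decrease; \<open>Poss a (definedness \<phi>)\<close> throughout
  would still be undefined where \<open>a\<close> is dead.
\<close>

primrec definedness :: "('ag, 'p) form \<Rightarrow> ('ag, 'p) form" where
  "definedness (Live a) = tautology a"
| "definedness (Atom a p) = Live a"
| "definedness (Neg \<phi>) = definedness \<phi>"
| "definedness (Conj \<phi> \<psi>) = Conj (definedness \<phi>) (definedness \<psi>)"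
| "definedness (Poss a \<phi>) = (if rank \<phi> = 0 then Live a else Poss a (definedness \<phi>))"

lemma rank_0_is_defined: "rank \<phi> = 0 \<Longrightarrow> is_defined M s \<phi>"
  by (induction \<phi>) auto

text \<open>Truncated predecessors commute with maxima. Under \<open>Poss\<close>, an argument of
  rank 0 is replaced by \<open>Live a\<close>, taking rank 1 to 0; otherwise the drop is inherited
  from the argument.\<close>

lemma rank_definedness: "rank (definedness \<phi>) = rank \<phi> - 1"
  by (induction \<phi>) (auto simp: max_def)

lemma definedness_language: "\<phi> \<in> language A P \<Longrightarrow> definedness \<phi> \<in> language A P"
  by (induction rule: language.induct) (auto intro: language.intros)

lemma is_true_definedness:
  assumes M: "partial_epistemic_model A P M" and "\<phi> \<in> language A P"
  shows "is_true M s (definedness \<phi>) \<longleftrightarrow> is_defined M s \<phi>"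
  using assms(2)
proof (induction arbitrary: s rule: language.induct)
  case (Poss a \<phi>)
  \<comment> \<open>Having any \<open>a\<close>-successor is the same as \<open>a\<close> being
    alive, so \<open>Live a\<close> expresses definedness of \<open>Poss a \<phi>\<close> when
    \<phi> is defined everywhere.\<close>
  have alive: "s \<in> alive_states M a \<longleftrightarrow> (\<exists>t. (s, t) \<in> rel M a)"
    using rel_imp_alive[OF M Poss.hyps(1)] by (auto simp: alive_states_def)
  show ?case
  proof (cases "rank \<phi> = 0")
    case True
    then show ?thesis
      by (simp add: alive rank_0_is_defined)
  next
    case False
    then show ?thesis
      by (simp add: Poss.IH)
  qed
qed auto

subsection \<open>Separating formulas\<close>

lemma separate_undefined:
  assumes M: "partial_epistemic_model A P M" and M': "partial_epistemic_model A P M'"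
    and "\<phi> \<in> language A P" "\<not> is_defined M t \<phi>" "is_defined M' t' \<phi>"
  shows "\<exists>\<psi>\<in>language A P. is_true M t \<psi> \<and> \<not> is_true M' t' \<psi>"
  using assms(3-)
proof (induction "rank \<phi>" arbitrary: \<phi> rule: less_induct)
  case less
  have L: "definedness \<phi> \<in> language A P"
    using less.prems definedness_language by blast
  have T: "\<not> is_true M t (definedness \<phi>)" "is_true M' t' (definedness \<phi>)"
    using less.prems is_true_definedness[OF M] is_true_definedness[OF M'] by auto
  show ?case
  proof (cases "is_defined M t (definedness \<phi>)")
    case True
    then show ?thesis
      using T by (intro bexI[of _ "Neg (definedness \<phi>)"] language.Neg L) auto
  next
    case False
    have "rank \<phi> \<noteq> 0"
      using less.prems rank_0_is_defined[of \<phi> M t] by blast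
    then have "rank (definedness \<phi>) < rank \<phi>"
      by (simp add: rank_definedness)
    \<comment> \<open>The induction hypothesis applies to \<open>definedness \<phi>\<close>:
      undefined at \<open>t\<close>, but true and hence defined at \<open>t'\<close>.\<close>
    then show ?thesis
      using less.hyps L False is_true_imp_is_defined[OF T(2)] by blast
  qed
qed

text \<open>The direction matters: negation cannot always exchange the two states, since the
  negation of an undefined formula is not true either. If \<phi> is defined at \<open>t\<close>
  only, \<open>definedness \<phi>\<close> itself separates.\<close>

lemma separate:
  assumes M: "partial_epistemic_model A P M" and M': "partial_epistemic_model A P M'"
    and neq: "\<not> par_equiv A P M t M' t'"
  shows "\<exists>\<psi>\<in>language A P. is_true M t \<psi> \<and> \<not> is_true M' t' \<psi>"
proof -
  \<comment> \<open>A disagreement on \<open>Neg \<phi>\<close> is already one on the definedness or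
    truth of \<phi>.\<close>
  obtain \<phi> where \<phi>: "\<phi> \<in> language A P"
    and "(is_defined M t \<phi> \<noteq> is_defined M' t' \<phi>) \<or> (is_true M t \<phi> \<noteq> is_true M' t' \<phi>)"
    using neq unfolding par_equiv_def by auto
  then consider
      "\<not> is_defined M t \<phi>" "is_defined M' t' \<phi>"
    | "is_defined M t \<phi>" "\<not> is_defined M' t' \<phi>"
    | "is_true M t \<phi>" "\<not> is_true M' t' \<phi>"
    | "is_defined M t \<phi>" "\<not> is_true M t \<phi>" "is_true M' t' \<phi>"
    using is_true_imp_is_defined[of M t \<phi>] is_true_imp_is_defined[of M' t' \<phi>] by blast
  then show ?thesis
  proof cases
    case 1
    then show ?thesis using separate_undefined[OF M M' \<phi>] by blast
  next
    case 2
    then show ?thesis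
      using is_true_definedness[OF M \<phi>] is_true_definedness[OF M' \<phi>]
        definedness_language[OF \<phi>] by blast
  next
    case 3
    then show ?thesis using \<phi> by blast
  next
    case 4
    then show ?thesis by (intro bexI[of _ "Neg \<phi>"] language.Neg \<phi>) auto
  qed
qed

text \<open>Conjoin one separating formula per element of \<open>F\<close>. A single conjunct that
  is not true, even an undefined one, keeps the conjunction from being true.\<close>

lemma separate_finite:
  assumes M: "partial_epistemic_model A P M" and M': "partial_epistemic_model A P M'"
    and "a \<in> A" "finite F" "\<forall>t'\<in>F. \<not> par_equiv A P M t M' t'"
  shows "\<exists>\<psi>\<in>language A P. is_true M t \<psi> \<and> (\<forall>t'\<in>F. \<not> is_true M' t' \<psi>)"
  using assms(4,5)
proof (induction F rule: finite_induct)
  case empty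
  \<comment> \<open>The syntax has no truth constant; the agent \<open>a\<close> supplies one as the
    empty conjunction.\<close>
  show ?case
    using assms(3) by (intro bexI[of _ "tautology a"]) (auto intro: language.intros)
next
  case (insert x F)
  obtain \<psi> where \<psi>: "\<psi> \<in> language A P" "is_true M t \<psi>" "\<forall>t'\<in>F. \<not> is_true M' t' \<psi>"
    using insert by auto
  obtain \<chi> where \<chi>: "\<chi> \<in> language A P" "is_true M t \<chi>" "\<not> is_true M' x \<chi>"
    using separate[OF M M'] insert.prems by blast
  show ?case
    using \<psi> \<chi> by (intro bexI[of _ "Conj \<chi> \<psi>"] language.Conj) auto
qed

subsection \<open>Par-equivalence is a life bisimulation\<close>

lemma par_equiv_sym: "par_equiv A P M s M' s' \<Longrightarrow> par_equiv A P M' s' M s"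
  unfolding par_equiv_def by blast

text \<open>If no \<open>a\<close>-successor of \<open>u'\<close> matched \<open>t\<close>, some
  \<psi> would be true at \<open>t\<close> and at none of these finitely many successors, so
  \<open>Poss a \<psi>\<close> would distinguish \<open>u\<close> from \<open>u'\<close>. Exchanging
  the models gives the back clause.\<close>

lemma par_equiv_forth:
  assumes M: "partial_epistemic_model A P M" and M': "partial_epistemic_model A P M'"
    and "image_finite A M'" "u' \<in> states M'"
    and eq: "par_equiv A P M u M' u'" and "a \<in> A" "(u, t) \<in> rel M a"
  shows "\<exists>t'. (u', t') \<in> rel M' a \<and> par_equiv A P M t M' t'"
proof (rule ccontr)
  assume "\<not> ?thesis"
  moreover have "finite (rel M' a `` {u'})"
    using assms unfolding image_finite_def by blast
  ultimately obtain \<psi> where \<psi>: "\<psi> \<in> language A P" "is_true M t \<psi>"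
      "\<forall>t'\<in>rel M' a `` {u'}. \<not> is_true M' t' \<psi>"
    using separate_finite[OF M M' \<open>a \<in> A\<close>, of "rel M' a `` {u'}" t] by auto
  have "is_true M u (Poss a \<psi>)"
    using \<psi> assms by auto
  moreover have "Poss a \<psi> \<in> language A P"
    using \<psi> \<open>a \<in> A\<close> by (intro language.Poss)
  ultimately have "is_true M' u' (Poss a \<psi>)"
    using eq unfolding par_equiv_def by blast
  then show False
    using \<psi> by auto
qed

lemma par_equiv_alive:
  assumes "par_equiv A P M u M' u'" "a \<in> A"
  shows "u \<in> alive_states M a \<longleftrightarrow> u' \<in> alive_states M' a"
proof -
  have "is_true M u (Live a) \<longleftrightarrow> is_true M' u' (Live a)"
    using assms language.Live[of a A P] unfolding par_equiv_def by blast
  then show ?thesis by simp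
qed

lemma par_equiv_atom:
  assumes eq: "par_equiv A P M u M' u'" and "a \<in> alive_agents A M u" "p \<in> P a"
  shows "Inr p \<in> val M u \<longleftrightarrow> Inr p \<in> val M' u'"
proof -
  have a: "a \<in> A" "u \<in> alive_states M a"
    using assms by (auto simp: alive_agents_def)
  have "is_true M u (Atom a p) \<longleftrightarrow> is_true M' u' (Atom a p)"
    using eq language.Atom[of a A p P] a assms(3) unfolding par_equiv_def by blast
  then show ?thesis
    using a par_equiv_alive[OF eq a(1)] by simp
qed

text \<open>The relation is cut down to the carriers because \<open>par_equiv\<close> makes sense
  for all elements of the state types.\<close>

lemma par_equiv_life_bisimulation:
  assumes M: "partial_epistemic_model A P M" "image_finite A M"
    and M': "partial_epistemic_model A P M'" "image_finite A M'"
    and "s \<in> states M" "s' \<in> states M'" "par_equiv A P M s M' s'"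
  shows "life_bisimulation A P M M'
    {(u, u'). u \<in> states M \<and> u' \<in> states M' \<and> par_equiv A P M u M' u'}"
    (is "life_bisimulation A P M M' ?Z")
  unfolding life_bisimulation_def
proof (intro conjI)
  show "?Z \<noteq> {}" "?Z \<subseteq> states M \<times> states M'"
    using assms by auto
  show "\<forall>(u, u')\<in>?Z.
        val M u \<inter> Inl ` A = val M' u' \<inter> Inl ` A \<and>
        (\<forall>a\<in>alive_agents A M u. val M u \<inter> Inr ` P a = val M' u' \<inter> Inr ` P a) \<and>
        (\<forall>a\<in>alive_agents A M u. \<forall>t. (u, t) \<in> rel M a \<longrightarrow>
           (\<exists>t'. (u', t') \<in> rel M' a \<and> (t, t') \<in> ?Z)) \<and>
        (\<forall>a\<in>alive_agents A M' u'. \<forall>t'. (u', t') \<in> rel M' a \<longrightarrow>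
           (\<exists>t. (u, t) \<in> rel M a \<and> (t, t') \<in> ?Z))"
  proof (intro ballI, clarify, intro conjI)
    fix u u'
    assume u: "u \<in> states M" "u' \<in> states M'" and eq: "par_equiv A P M u M' u'"
    show "val M u \<inter> Inl ` A = val M' u' \<inter> Inl ` A"
      using Inl_val_iff[OF M(1) _ u(1)] Inl_val_iff[OF M'(1) _ u(2)] par_equiv_alive[OF eq] by auto
    show "\<forall>a\<in>alive_agents A M u. val M u \<inter> Inr ` P a = val M' u' \<inter> Inr ` P a"
      using par_equiv_atom[OF eq] by auto
    show "\<forall>a\<in>alive_agents A M u. \<forall>t. (u, t) \<in> rel M a \<longrightarrow>
        (\<exists>t'. (u', t') \<in> rel M' a \<and> (t, t') \<in> ?Z)"
    proof (intro ballI allI impI)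
      fix a t
      assume "a \<in> alive_agents A M u" and t: "(u, t) \<in> rel M a"
      then have a: "a \<in> A" by (simp add: alive_agents_def)
      show "\<exists>t'. (u', t') \<in> rel M' a \<and> (t, t') \<in> ?Z"
        using par_equiv_forth[OF M(1) M' u(2) eq a t]
          rel_imp_states[OF M(1) a t] rel_imp_states[OF M'(1) a] by auto
    qed
    show "\<forall>a\<in>alive_agents A M' u'. \<forall>t'. (u', t') \<in> rel M' a \<longrightarrow>
        (\<exists>t. (u, t) \<in> rel M a \<and> (t, t') \<in> ?Z)"
    proof (intro ballI allI impI)
      fix a t'
      assume "a \<in> alive_agents A M' u'" and t': "(u', t') \<in> rel M' a"
      then have a: "a \<in> A" by (simp add: alive_agents_def)
      show "\<exists>t. (u, t) \<in> rel M a \<and> (t, t') \<in> ?Z"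
        using par_equiv_forth[OF M'(1) M u(1) par_equiv_sym[OF eq] a t']
          rel_imp_states[OF M'(1) a t'] rel_imp_states[OF M(1) a] par_equiv_sym by fast
    qed
  qed
qed

subsection \<open>Invariance under life bisimulations\<close>

lemma life_bisimulationD:
  assumes "life_bisimulation A P M M' Z" "(u, u') \<in> Z"
  shows "u \<in> states M" "u' \<in> states M'"
    and "val M u \<inter> Inl ` A = val M' u' \<inter> Inl ` A"
    and "a \<in> alive_agents A M u \<Longrightarrow> val M u \<inter> Inr ` P a = val M' u' \<inter> Inr ` P a"
    and "a \<in> alive_agents A M u \<Longrightarrow> (u, t) \<in> rel M a \<Longrightarrow> \<exists>t'. (u', t') \<in> rel M' a \<and> (t, t') \<in> Z"
    and "a \<in> alive_agents A M' u' \<Longrightarrow> (u', t') \<in> rel M' a \<Longrightarrow> \<exists>t. (u, t) \<in> rel M a \<and> (t, t') \<in> Z"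
proof -
  note Z = assms(1)[unfolded life_bisimulation_def, THEN conjunct2]
  show "u \<in> states M" "u' \<in> states M'"
    using Z[THEN conjunct1] assms(2) by auto
  note B = Z[THEN conjunct2, THEN bspec, OF assms(2), unfolded prod.case]
  show "val M u \<inter> Inl ` A = val M' u' \<inter> Inl ` A"
    using B by (rule conjunct1)
  show "a \<in> alive_agents A M u \<Longrightarrow> val M u \<inter> Inr ` P a = val M' u' \<inter> Inr ` P a"
    "a \<in> alive_agents A M u \<Longrightarrow> (u, t) \<in> rel M a \<Longrightarrow> \<exists>t'. (u', t') \<in> rel M' a \<and> (t, t') \<in> Z"
    "a \<in> alive_agents A M' u' \<Longrightarrow> (u', t') \<in> rel M' a \<Longrightarrow> \<exists>t. (u, t) \<in> rel M a \<and> (t, t') \<in> Z"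
    using B[THEN conjunct2] by simp_all
qed

lemma life_bisimulation_alive:
  assumes M: "partial_epistemic_model A P M" and M': "partial_epistemic_model A P M'"
    and Z: "life_bisimulation A P M M' Z" "(u, u') \<in> Z" and "a \<in> A"
  shows "u \<in> alive_states M a \<longleftrightarrow> u' \<in> alive_states M' a"
proof -
  have "Inl a \<in> val M u \<longleftrightarrow> Inl a \<in> val M' u'"
    using life_bisimulationD(3)[OF Z] \<open>a \<in> A\<close> by blast
  then show ?thesis
    using life_bisimulationD(1,2)[OF Z] Inl_val_iff[OF M \<open>a \<in> A\<close>] Inl_val_iff[OF M' \<open>a \<in> A\<close>]
    by blast
qed

text \<open>The bisimulation clause speaks of living agents only, but an outgoing edge already
  forces its agent to be alive.\<close>

lemma life_bisimulation_forth:
  assumes "partial_epistemic_model A P M" "life_bisimulation A P M M' Z" "(u, u') \<in> Z" "a \<in> A"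
    and "(u, t) \<in> rel M a"
  shows "\<exists>t'. (u', t') \<in> rel M' a \<and> (t, t') \<in> Z"
proof -
  have "a \<in> alive_agents A M u"
    using rel_imp_alive[OF assms(1,4,5)] \<open>a \<in> A\<close> by (simp add: alive_agents_def)
  then show ?thesis
    using life_bisimulationD(5)[OF assms(2,3) _ assms(5)] by blast
qed

lemma life_bisimulation_back:
  assumes "partial_epistemic_model A P M'" "life_bisimulation A P M M' Z" "(u, u') \<in> Z" "a \<in> A"
    and "(u', t') \<in> rel M' a"
  shows "\<exists>t. (u, t) \<in> rel M a \<and> (t, t') \<in> Z"
proof -
  have "a \<in> alive_agents A M' u'"
    using rel_imp_alive[OF assms(1,4,5)] \<open>a \<in> A\<close> by (simp add: alive_agents_def)
  then show ?thesis
    using life_bisimulationD(6)[OF assms(2,3) _ assms(5)] by blast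
qed

text \<open>Definedness and truth share one induction because the truth of a negation depends on
  both.\<close>

lemma life_bisimulation_invariant:
  assumes M: "partial_epistemic_model A P M" and M': "partial_epistemic_model A P M'"
    and Z: "life_bisimulation A P M M' Z"
    and "\<phi> \<in> language A P" "(u, u') \<in> Z"
  shows "(is_defined M u \<phi> \<longleftrightarrow> is_defined M' u' \<phi>) \<and> (is_true M u \<phi> \<longleftrightarrow> is_true M' u' \<phi>)"
  using assms(4-)
proof (induction arbitrary: u u' rule: language.induct)
  case (Live a)
  then show ?case
    using life_bisimulation_alive[OF M M' Z] by simp
next
  case (Atom a p)
  have alive: "u \<in> alive_states M a \<longleftrightarrow> u' \<in> alive_states M' a"
    using life_bisimulation_alive[OF M M' Z] Atom by blast
  \<comment> \<open>Where \<open>a\<close> is dead, the atom is undefined and not true on both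
    sides, so valuations need comparing only where \<open>a\<close> is alive.\<close>
  have "Inr p \<in> val M u \<longleftrightarrow> Inr p \<in> val M' u'" if "u \<in> alive_states M a"
  proof -
    have "a \<in> alive_agents A M u"
      using that Atom by (simp add: alive_agents_def)
    then have "val M u \<inter> Inr ` P a = val M' u' \<inter> Inr ` P a"
      using life_bisimulationD(4)[OF Z Atom.prems] by blast
    then show ?thesis
      using Atom.hyps by blast
  qed
  then show ?case
    using alive by auto
next
  case (Poss a \<phi>)
  \<comment> \<open>Definedness of \<open>Poss a \<phi>\<close> is existential just like its truth,
    so the same matching of successors transfers both.\<close>
  note zig = life_bisimulation_forth[OF M Z Poss.prems Poss.hyps(1)]
  note zag = life_bisimulation_back[OF M' Z Poss.prems Poss.hyps(1)]
  show ?case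
    unfolding is_defined.simps is_true.simps using zig zag Poss.IH by meson
qed auto

theorem theorem5p10:
  fixes A :: "'ag set" and P :: "'ag \<Rightarrow> 'p set"
    and M :: "('ag, 'p, 's) model" and M' :: "('ag, 'p, 't) model"
    and s :: 's and s' :: 't
  assumes "signature A P"
    and "partial_epistemic_model A P M" and "image_finite A M" and "s \<in> states M"
    and "partial_epistemic_model A P M'" and "image_finite A M'" and "s' \<in> states M'"
  shows "life_bisimilar A P M s M' s' \<longleftrightarrow> par_equiv A P M s M' s'"
proof
  assume "life_bisimilar A P M s M' s'"
  then obtain Z where "life_bisimulation A P M M' Z" "(s, s') \<in> Z"
    unfolding life_bisimilar_def by blast
  then show "par_equiv A P M s M' s'"
    unfolding par_equiv_def
    using life_bisimulation_invariant[OF assms(2,5)] by simp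
next
  assume "par_equiv A P M s M' s'"
  then show "life_bisimilar A P M s M' s'"
    unfolding life_bisimilar_def
    using par_equiv_life_bisimulation[OF assms(2,3,5,6,4,7)] assms(4,7) by blast
qed

end
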